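(* Let $X$ be a real vector space. Suppose that the following separation property holds in $X$: for every convex set $\Omega\subset X$ with $\mathrm{core}(\Omega)\neq\emptyset$ and every $x_0\in X$ with $x_0\notin\Omega$, the sets $\Omega$ and $\{x_0\}$ are properly separated by a hyperplane, and, in the case where $\Omega=\mathrm{core}(\Omega)$, there is a nonzero linear function $f\colon X\to\mathbb{R}$ with $f(x)<f(x_0)$ for all $x\in\Omega$. Then the Hahn-Banach theorem holds in $X$: for every sublinear function $p\colon X\to\mathbb{R}$, every linear subspace $Y\subset X$, and every linear function $g\colon Y\to\mathbb{R}$ with $g(y)\le p(y)$ for all $y\in Y$, there exists a linear function $f\colon X\to\mathbb{R}$ such that $f(y)=g(y)$ for all $y\in Y$ and $f(x)\le p(x)$ for all $x\in X$.
   Context: All vector spaces are real and carry no topology. For a nonempty set $\Omega\subset X$, the algebraic core is $\mathrm{core}(\Omega):=\{x\in\Omega\mid \forall v\in X\ \exists\delta>0\ \forall t\in\mathbb{R}\text{ with }|t|<\delta:\ x+tv\in\Omega\}$. Two nonempty sets $\Omega_1,\Omega_2\subset X$ are separated (by a hyperplane) if there is a nonzero linear function $f\colon X\to\mathbb{R}$ with $\sup\{f(x)\mid x\in\Omega_1\}\le\inf\{f(x)\mid x\in\Omega_2\}$; they are properly separated if, in addition, the same $f$ satisfies $\inf\{f(x)\mid x\in\Omega_1\}<\sup\{f(x)\mid x\in\Omega_2\}$. A function $p\colon X\to\mathbb{R}$ is sublinear if it is positively homogeneous and subadditive, i.e., $p(x_1+x_2)\le p(x_1)+p(x_2)$ for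 all $x_1,x_2\in X$. The theorem is meant as a derivation of the Hahn-Banach extension theorem from the stated separation property. *)

theory Defs
  imports "HOL-Analysis.Analysis"
begin

definition alg_core :: "'a::real_vector set \<Rightarrow> 'a set" where
  "alg_core \<Omega> = {x \<in> \<Omega>. \<forall>v. \<exists>\<delta>>0. \<forall>t::real. \<bar>t\<bar> < \<delta> \<longrightarrow> x + t *\<^sub>R v \<in> \<Omega>}"

(* Suprema and infima are taken in the extended reals: f need not be bounded on A or B. *)
definition separated_by :: "('a::real_vector \<Rightarrow> real) \<Rightarrow> 'a set \<Rightarrow> 'a set \<Rightarrow> bool" where
  "separated_by f A B \<longleftrightarrow>
     A \<noteq> {} \<and> B \<noteq> {} \<and> linear f \<and> f \<noteq> (\<lambda>x. 0) \<and>
     (SUP x\<in>A. ereal (f x)) \<le> (INF x\<in>B. ereal (f x))"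

definition properly_separated :: "'a::real_vector set \<Rightarrow> 'a set \<Rightarrow> bool" where
  "properly_separated A B \<longleftrightarrow>
     (\<exists>f. separated_by f A B \<and> (INF x\<in>A. ereal (f x)) < (SUP x\<in>B. ereal (f x)))"

(* For real-valued p, homogeneity for t > 0 and subadditivity already force p 0 = 0. *)
definition sublinear :: "('a::real_vector \<Rightarrow> real) \<Rightarrow> bool" where
  "sublinear p \<longleftrightarrow>
     (\<forall>t>0. \<forall>x. p (t *\<^sub>R x) = t * p x) \<and> (\<forall>x y. p (x + y) \<le> p x + p y)"

(* Linearity of a function whose domain is the subspace Y; its values outside Y are junk. *)
definition linear_on_subspace :: "'a::real_vector set \<Rightarrow> ('a \<Rightarrow> real) \<Rightarrow> bool" where
  "linear_on_subspace Y g \<longleftrightarrow>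
     (\<forall>x\<in>Y. \<forall>y\<in>Y. g (x + y) = g x + g y) \<and> (\<forall>c. \<forall>x\<in>Y. g (c *\<^sub>R x) = c * g x)"

end

theory Submission
  imports Defs
begin

text \<open>
  The separation property is used in \<open>X\<close> itself, not in \<open>X \<times> \<real>\<close>. First, every sublinear \<open>q\<close>
  dominates a linear function: if \<open>q \<ge> 0\<close>, the zero function will do; otherwise choose \<open>x0\<close> with
  \<open>q x0 = -1\<close> and strictly separate \<open>x0\<close> from the set \<open>{x. q x < -1}\<close>, which equals its own
  core. The separating functional, scaled to take the value \<open>-1\<close> at \<open>x0\<close>, satisfies
  \<open>f x < -1\<close> whenever \<open>q x < -1\<close>, and translating along \<open>x0\<close> turns this into \<open>f \<le> q\<close>. The
  Hahn-Banach theorem follows by applying this to the infimal convolution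
  \<open>q x = (INF y\<in>Y. p (x - y) + g y)\<close>: a linear \<open>f \<le> q\<close> satisfies \<open>f \<le> p\<close> on \<open>X\<close> and
  \<open>f \<le> g\<close> on \<open>Y\<close>, hence \<open>f = g\<close> on \<open>Y\<close>.
\<close>

lemma sublinear_scale: "sublinear p \<Longrightarrow> t > 0 \<Longrightarrow> p (t *\<^sub>R x) = t * p x"
  by (simp add: sublinear_def)

lemma sublinear_add_le: "sublinear p \<Longrightarrow> p (x + y) \<le> p x + p y"
  by (simp add: sublinear_def)

lemma sublinear_zero: "sublinear p \<Longrightarrow> p 0 = 0"
  using sublinear_scale[of p 2 0] by simp

lemma sublinear_scale_nonneg: "sublinear p \<Longrightarrow> t \<ge> 0 \<Longrightarrow> p (t *\<^sub>R x) = t * p x"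
  using sublinear_scale[of p t x] sublinear_zero[of p] by (cases "t = 0") auto

text \<open>Since \<open>p\<close> may behave differently at \<open>v\<close> and
  \<open>- v\<close>, both values enter, giving one linear bound for either sign of
  \<open>t\<close>.\<close>

lemma sublinear_scale_le:
  assumes "sublinear p"
  shows "p (t *\<^sub>R v) \<le> \<bar>t\<bar> * (\<bar>p v\<bar> + \<bar>p (- v)\<bar>)"
proof (cases "t \<ge> 0")
  case True
  then have "p (t *\<^sub>R v) = t * p v"
    by (rule sublinear_scale_nonneg[OF assms])
  also have "\<dots> \<le> t * (\<bar>p v\<bar> + \<bar>p (- v)\<bar>)"
    using True by (intro mult_left_mono) auto
  finally show ?thesis using True by simp
next
  case False
  then have "p (t *\<^sub>R v) = - t * p (- v)"
    using sublinear_scale[OF assms, of "- t" "- v"] by simp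
  also have "\<dots> \<le> - t * (\<bar>p v\<bar> + \<bar>p (- v)\<bar>)"
    using False by (intro mult_left_mono) auto
  finally show ?thesis using False by simp
qed

lemma convex_sublinear_sublevel:
  assumes "sublinear p"
  shows "convex {x. p x < c}"
proof (rule convexI)
  fix x y and u v :: real
  assume "x \<in> {x. p x < c}" "y \<in> {x. p x < c}" and uv: "0 \<le> u" "0 \<le> v" "u + v = 1"
  then have xy: "p x < c" "p y < c" by auto
  have "p (u *\<^sub>R x + v *\<^sub>R y) \<le> u * p x + v * p y"
    using sublinear_add_le[OF assms, of "u *\<^sub>R x" "v *\<^sub>R y"] uv
    by (simp add: sublinear_scale_nonneg[OF assms])
  also have "\<dots> < c"
    using convex_bound_lt[OF xy uv] .
  finally show "u *\<^sub>R x + v *\<^sub>R y \<in> {x. p x < c}" by simp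
qed

text \<open>Along any line through \<open>x\<close>, \<open>p\<close> grows at most linearly in
  \<open>\<bar>t\<bar>\<close>, so the strict inequality survives small steps.\<close>

lemma alg_core_sublinear_sublevel:
  assumes "sublinear p"
  shows "alg_core {x. p x < c} = {x. p x < c}"
proof -
  have "\<exists>\<delta>>0. \<forall>t. \<bar>t\<bar> < \<delta> \<longrightarrow> p (x + t *\<^sub>R v) < c" if x: "p x < c" for x v
  proof -
    \<comment> \<open>The summand 1 keeps the divisor positive even if \<open>p\<close> vanishes at
      \<open>v\<close> and \<open>- v\<close>.\<close>
    define M where "M = \<bar>p v\<bar> + \<bar>p (- v)\<bar> + 1"
    have M: "M > 0" by (simp add: M_def)
    have "p (x + t *\<^sub>R v) < c" if t: "\<bar>t\<bar> < (c - p x) / M" for t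
    proof -
      have "p (x + t *\<^sub>R v) \<le> p x + \<bar>t\<bar> * (\<bar>p v\<bar> + \<bar>p (- v)\<bar>)"
        using sublinear_add_le[OF assms, of x "t *\<^sub>R v"] sublinear_scale_le[OF assms, of t v]
        by linarith
      also have "\<dots> \<le> p x + \<bar>t\<bar> * M"
        by (intro add_left_mono mult_left_mono) (auto simp: M_def)
      also have "\<dots> < c"
        using t M by (simp add: pos_less_divide_eq)
      finally show ?thesis .
    qed
    moreover have "(c - p x) / M > 0" using x M by simp
    ultimately show ?thesis by blast
  qed
  then show ?thesis unfolding alg_core_def by auto
qed

lemma sublinear_dominates_linear:
  fixes q :: "'a::real_vector \<Rightarrow> real"
  assumes separation: "\<And>(\<Omega> :: 'a set) x0. convex \<Omega> \<Longrightarrow> \<Omega> \<noteq> {} \<Longrightarrow> alg_core \<Omega> = \<Omega> \<Longrightarrow> x0 \<notin> \<Omega> \<Longrightarrow>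
      \<exists>f :: 'a \<Rightarrow> real. linear f \<and> (\<forall>x\<in>\<Omega>. f x < f x0)"
    and q: "sublinear q"
  obtains f where "linear f" "\<And>x. f x \<le> q x"
proof (cases "\<forall>x. q x \<ge> 0")
  case True
  then show ?thesis using that[of "\<lambda>x. 0"] by (simp add: linear_zero)
next
  case False
  then obtain z where z: "q z < 0" by (auto simp: not_le)
  define x0 where "x0 = (- 1 / q z) *\<^sub>R z"
  have x0: "q x0 = - 1"
    using sublinear_scale[OF q, of "- 1 / q z" z] z by (simp add: x0_def)
  \<comment> \<open>The point \<open>2 *\<^sub>R x0\<close> shows that the sublevel set is nonempty,
    and \<open>f (2 *\<^sub>R x0) < f x0\<close> then forces \<open>f x0 < 0\<close>.\<close>
  have x1: "q (2 *\<^sub>R x0) < - 1"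
    using sublinear_scale[OF q, of 2 x0] x0 by simp
  obtain f :: "'a \<Rightarrow> real" where f: "linear f" and less: "\<And>x. q x < - 1 \<Longrightarrow> f x < f x0"
    using separation[OF convex_sublinear_sublevel[OF q] _ alg_core_sublinear_sublevel[OF q],
        of "- 1" x0] x0 x1 by auto
  have neg: "f x0 < 0"
    using less[OF x1] by (simp add: linear_scale[OF f])
  define h where "h = (\<lambda>x. (- 1 / f x0) *\<^sub>R f x)"
  have h: "linear h"
    unfolding h_def by (rule linear_compose_scale_right[OF f])
  have hx0: "h x0 = - 1" using neg by (simp add: h_def)
  have hless: "h x < - 1" if "q x < - 1" for x
    using less[OF that] neg by (simp add: h_def field_simps)
  have le: "h x \<le> q x" if x: "q x \<ge> - 1" for x
  \<comment> \<open>For \<open>c > q x\<close> the coefficient \<open>c + 1\<close> is positive.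
    Adding \<open>(c + 1) *\<^sub>R x0\<close> brings \<open>q\<close> below -1 and lowers
    \<open>h\<close> by exactly \<open>c + 1\<close>, so \<open>hless\<close> yields
    \<open>h x < c\<close>.\<close>
  proof (rule dense_ge)
    fix c assume c: "q x < c"
    have "q (x + (c + 1) *\<^sub>R x0) \<le> q x + (c + 1) * q x0"
      using sublinear_add_le[OF q, of x "(c + 1) *\<^sub>R x0"] x c
      by (simp add: sublinear_scale_nonneg[OF q])
    then have "q (x + (c + 1) *\<^sub>R x0) < - 1" using c x0 by simp
    then have "h (x + (c + 1) *\<^sub>R x0) < - 1" by (rule hless)
    then show "h x \<le> c"
      by (simp add: linear_add[OF h] linear_scale[OF h] hx0)
  qed
  have "h x \<le> q x" for x
  proof -
    \<comment> \<open>Shrinking by \<open>r\<close> moves any \<open>x\<close> into the region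
      covered by \<open>le\<close>; homogeneity carries the inequality back.\<close>
    define r where "r = 1 / (1 + \<bar>q x\<bar>)"
    have r: "r > 0" by (simp add: r_def add_pos_nonneg)
    have "- 1 \<le> r * q x"
      by (simp add: r_def field_simps add_pos_nonneg)
    then have "q (r *\<^sub>R x) \<ge> - 1"
      using sublinear_scale[OF q r, of x] by simp
    from le[OF this] have "r * h x \<le> r * q x"
      by (simp add: linear_scale[OF h] sublinear_scale[OF q r])
    then show ?thesis using r by simp
  qed
  with h show ?thesis by (rule that)
qed

context
  fixes p g :: "'a::real_vector \<Rightarrow> real" and Y :: "'a set"
  assumes p: "sublinear p" and Y: "subspace Y" and g: "linear_on_subspace Y g"
    and gp: "\<And>y. y \<in> Y \<Longrightarrow> g y \<le> p y"
begin

text \<open>With \<open>g\<close> set to \<infinity> off \<open>Y\<close>, this is the largest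
  sublinear function below \<open>p\<close> everywhere and below \<open>g\<close> on
  \<open>Y\<close>.\<close>

definition inf_conv :: "'a \<Rightarrow> real" where
  "inf_conv x = (INF y\<in>Y. p (x - y) + g y)"

lemma linear_on_subspace_neg: "y \<in> Y \<Longrightarrow> g (- y) = - g y"
  using g unfolding linear_on_subspace_def by (metis mult_minus1 scaleR_minus1_left)

text \<open>This makes the real infimum meaningful. The bound comes from \<open>g \<le> p\<close> at
  \<open>- y\<close> and subadditivity.\<close>

lemma bdd_below_inf_conv: "bdd_below ((\<lambda>y. p (x - y) + g y) ` Y)"
proof (rule bdd_belowI2)
  fix y assume y: "y \<in> Y"
  have "- g y \<le> p (- y)"
    using gp[of "- y"] linear_on_subspace_neg[OF y] subspace_neg[OF Y y] by simp
  also have "\<dots> \<le> p (x - y) + p (- x)"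
    using sublinear_add_le[OF p, of "x - y" "- x"] by simp
  finally show "- p (- x) \<le> p (x - y) + g y" by simp
qed

lemma inf_conv_le: "y \<in> Y \<Longrightarrow> inf_conv x \<le> p (x - y) + g y"
  unfolding inf_conv_def by (rule cINF_lower[OF bdd_below_inf_conv])

lemma le_inf_conv: "(\<And>y. y \<in> Y \<Longrightarrow> c \<le> p (x - y) + g y) \<Longrightarrow> c \<le> inf_conv x"
  unfolding inf_conv_def using subspace_0[OF Y] by (intro cINF_greatest) auto

lemma inf_conv_add_le: "inf_conv (x + z) \<le> inf_conv x + inf_conv z"
proof -
  have "inf_conv (x + z) \<le> (p (z - w) + g w) + (p (x - y) + g y)" if "y \<in> Y" "w \<in> Y" for y w
  proof -
    have "inf_conv (x + z) \<le> p ((x + z) - (y + w)) + g (y + w)"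
      using subspace_add[OF Y that] by (rule inf_conv_le)
    moreover have "p ((x + z) - (y + w)) \<le> p (x - y) + p (z - w)"
      using sublinear_add_le[OF p, of "x - y" "z - w"] by (simp add: algebra_simps)
    moreover have "g (y + w) = g y + g w"
      using g that by (simp add: linear_on_subspace_def)
    ultimately show ?thesis by simp
  qed
  \<comment> \<open>The two infima are taken in turn: over \<open>w\<close> with \<open>y\<close>
    fixed, then over \<open>y\<close>.\<close>
  then have "inf_conv (x + z) - (p (x - y) + g y) \<le> inf_conv z" if "y \<in> Y" for y
    using that by (intro le_inf_conv) (simp add: diff_le_eq)
  then have "inf_conv (x + z) - inf_conv z \<le> inf_conv x"
    by (intro le_inf_conv) (simp add: algebra_simps)
  then show ?thesis by simp
qed

text \<open>If \<open>y\<close> competes for \<open>x\<close>, then \<open>t *\<^sub>R y\<close>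
  competes for \<open>t *\<^sub>R x\<close> at \<open>t\<close> times the cost.\<close>

lemma inf_conv_scale_le:
  assumes t: "t > 0"
  shows "inf_conv (t *\<^sub>R x) \<le> t * inf_conv x"
proof -
  have "inf_conv (t *\<^sub>R x) / t \<le> p (x - y) + g y" if y: "y \<in> Y" for y
  proof -
    have "inf_conv (t *\<^sub>R x) \<le> p (t *\<^sub>R x - t *\<^sub>R y) + g (t *\<^sub>R y)"
      using subspace_scale[OF Y y] by (rule inf_conv_le)
    also have "\<dots> = t * (p (x - y) + g y)"
      using g y sublinear_scale[OF p t, of "x - y"]
      by (simp add: linear_on_subspace_def algebra_simps)
    finally show ?thesis using t by (simp add: pos_divide_le_eq mult.commute)
  qed
  then have "inf_conv (t *\<^sub>R x) / t \<le> inf_conv x" by (rule le_inf_conv)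
  then show ?thesis using t by (simp add: pos_divide_le_eq mult.commute)
qed

lemma sublinear_inf_conv: "sublinear inf_conv"
proof -
  have "inf_conv (t *\<^sub>R x) = t * inf_conv x" if t: "t > 0" for t x
  proof (rule antisym[OF inf_conv_scale_le[OF t]])
    \<comment> \<open>The reverse inequality is the same estimate for the factor
      \<open>inverse t\<close> at the point \<open>t *\<^sub>R x\<close>.\<close>
    have "inf_conv x \<le> inverse t * inf_conv (t *\<^sub>R x)"
      using inf_conv_scale_le[of "inverse t" "t *\<^sub>R x"] t by simp
    then show "t * inf_conv x \<le> inf_conv (t *\<^sub>R x)"
      using t by (simp add: field_simps)
  qed
  then show ?thesis by (simp add: sublinear_def inf_conv_add_le)
qed

lemma inf_conv_le_sublinear: "inf_conv x \<le> p x"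
  \<comment> \<open>The competitor is \<open>y = 0\<close>; the negation rule at 0 gives
    \<open>g 0 = 0\<close>.\<close>
  using inf_conv_le[of 0 x] linear_on_subspace_neg[of 0] subspace_0[OF Y] by simp

lemma inf_conv_le_on_subspace: "y \<in> Y \<Longrightarrow> inf_conv y \<le> g y"
  using inf_conv_le[of y y] sublinear_zero[OF p] by simp

text \<open>An inequality between linear functions on a subspace is an equality, as evaluating it at
  \<open>- y\<close> reverses it.\<close>

lemma linear_le_inf_conv_eq:
  assumes f: "linear f" and le: "\<And>x. f x \<le> inf_conv x" and y: "y \<in> Y"
  shows "f y = g y"
proof (rule antisym)
  show "f y \<le> g y"
    using le[of y] inf_conv_le_on_subspace[OF y] by linarith
  have "f (- y) \<le> g (- y)"
    using le[of "- y"] inf_conv_le_on_subspace[OF subspace_neg[OF Y y]] by linarith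
  then show "g y \<le> f y"
    by (simp add: linear_neg[OF f] linear_on_subspace_neg[OF y])
qed

end

theorem theorem3p6:
  assumes separation:
    "\<And>(\<Omega> :: 'a::real_vector set) x0. convex \<Omega> \<Longrightarrow> alg_core \<Omega> \<noteq> {} \<Longrightarrow> x0 \<notin> \<Omega> \<Longrightarrow>
       properly_separated \<Omega> {x0} \<and>
       (\<Omega> = alg_core \<Omega> \<longrightarrow> (\<exists>f. linear f \<and> f \<noteq> (\<lambda>x. 0) \<and> (\<forall>x\<in>\<Omega>. f x < (f x0 :: real))))"
  shows "\<forall>(p :: 'a \<Rightarrow> real) Y g.
           sublinear p \<and> subspace Y \<and> linear_on_subspace Y g \<and> (\<forall>y\<in>Y. g y \<le> p y) \<longrightarrow>
           (\<exists>f. linear f \<and> (\<forall>y\<in>Y. f y = g y) \<and> (\<forall>x. f x \<le> p x))"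
proof (intro allI impI)
  fix p g :: "'a \<Rightarrow> real" and Y
  assume "sublinear p \<and> subspace Y \<and> linear_on_subspace Y g \<and> (\<forall>y\<in>Y. g y \<le> p y)"
  then have *: "sublinear p" "subspace Y" "linear_on_subspace Y g" "\<And>y. y \<in> Y \<Longrightarrow> g y \<le> p y"
    by auto
  \<comment> \<open>A nonempty set equal to its core has nonempty core, so the strict case of the
    separation property applies.\<close>
  have "\<exists>f :: 'a \<Rightarrow> real. linear f \<and> (\<forall>x\<in>\<Omega>. f x < f x0)"
    if "convex \<Omega>" "\<Omega> \<noteq> {}" "alg_core \<Omega> = \<Omega>" "x0 \<notin> \<Omega>" for \<Omega> :: "'a set" and x0
    using separation[of \<Omega> x0] that by auto
  then obtain f where f: "linear f" "\<And>x. f x \<le> inf_conv p g Y x"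
    using sublinear_dominates_linear[OF _ sublinear_inf_conv[OF *]] by blast
  have "f x \<le> p x" for x
    using f(2)[of x] inf_conv_le_sublinear[OF *, of x] by linarith
  then show "\<exists>f. linear f \<and> (\<forall>y\<in>Y. f y = g y) \<and> (\<forall>x. f x \<le> p x)"
    using f(1) linear_le_inf_conv_eq[OF * f] by blast
qed

end
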